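(* Let $\pi^{(1)},\dots,\pi^{(K)}$ be target policies in a finite-horizon MDP with horizon $T$, and let $\hat\mu$ be the behavior policy $\hat\mu_t(a|s)\propto\sqrt{\sum_{k=1}^K\pi^{(k)}_t(a|s)^2\hat q_{\pi^{(k)},t}(s,a)}$. Then for all $k\in\{1,\dots,K\}$, $t\in\{0,\dots,T-1\}$ and $s\in\mathcal S$, $$\mathbb V\left(G^{\mathrm{PDIS}}_k\left(\tau^{\hat\mu_{t:T-1}}_{t:T-1}\right)\,\middle|\,S_t=s\right)\le\mathbb V\left(G^{\mathrm{PDIS}}_k\left(\tau^{\pi^{(k)}_{t:T-1}}_{t:T-1}\right)\,\middle|\,S_t=s\right),$$ if the similarity $\eta$ satisfies, for all $k$, $t$ and $s$, $$\sqrt{\frac{\overline\eta_t}{\underline\eta_t}}\left(\sum_a\pi^{(k)}_t(a|s)\sqrt{\hat q_{\pi^{(k)},t}(s,a)}\right)^2\le\sum_a\pi^{(k)}_t(a|s)\,\hat q_{\pi^{(k)},t}(s,a).$$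
   Context: Setting. A finite-horizon MDP has a finite state space $\mathcal S$, finite action space $\mathcal A$, deterministic reward function $r:\mathcal S\times\mathcal A\to\mathbb R$, transition probabilities $p(s'|s,a)$, and horizon $T$. A (time-dependent) policy is a family $\mu=(\mu_t)_{t=0}^{T-1}$ where $\mu_t(\cdot|s)$ is a probability distribution on $\mathcal A$ for every $s$. Under $\mu$, at time $t$, $A_t\sim\mu_t(\cdot|S_t)$, $R_{t+1}=r(S_t,A_t)$, $S_{t+1}\sim p(\cdot|S_t,A_t)$. There are $K$ target policies $\pi^{(1)},\dots,\pi^{(K)}$. Conditioning on $S_t=s$ means starting the process at time $t$ in state $s$. Value functions (undiscounted): $v_{\pi,t}(s)=\mathbb E_\pi[\sum_{i=t+1}^T R_i\mid S_t=s]$ and $q_{\pi,t}(s,a)=\mathbb E_\pi[\sum_{i=t+1}^T R_i\mid S_t=s,A_t=a]$. $\tau^{\mu_{t:T-1}}_{t:T-1}=\{S_t,A_t,R_{t+1},\dots,S_{T-1},A_{T-1},R_T\}$ denotes a random trajectory segment generated by $\mu$ from time $t$ to $T-1$. The per-decision importance sampling (PDIS) estimator for $\pi^{(k)}$ from data generated by $\mu$ is $$G^{\mathrm{PDIS}}_k\left(\tau^{\mu_{t:T-1}}_{t:T-1}\right)=\sum_{i=t}^{T-1}\left(\prod_{j=t}^{i}\rho^{\pi^{(k)},\mu}_j\right)R_{i+1},\qquad \rho^{\pi^{(k)},\mu}_j=\frac{\pi^{(k)}_j(A_j|S_j)}{\mu_j(A_j|S_j)}.$$ $\mathbb V$ denotes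 variance. Define $\nu_{\pi^{(k)},T-1}(s,a)=0$ and $\nu_{\pi^{(k)},t}(s,a)=\mathbb V\left(v_{\pi^{(k)},t+1}(S_{t+1})\mid S_t=s,A_t=a\right)$ for $t\le T-2$. Define $\hat q_{\pi^{(k)},T-1}(s,a)=q_{\pi^{(k)},T-1}(s,a)^2$, and for $t\le T-2$, $$\hat q_{\pi^{(k)},t}(s,a)=q_{\pi^{(k)},t}(s,a)^2+\nu_{\pi^{(k)},t}(s,a)+\sum_{s'}p(s'|s,a)\,\mathbb V\left(G^{\mathrm{PDIS}}_k\left(\tau^{\pi^{(k)}_{t+1:T-1}}_{t+1:T-1}\right)\,\middle|\,S_{t+1}=s'\right).$$ The notation $\mu(a)\propto f(a)$ with $f\ge0$ means $\mu(a)=f(a)/\sum_b f(b)$ (uniform if $f\equiv0$). Similarity: $w^{(k)}_t(s,a)=\pi^{(k)}_t(a|s)^2\hat q_{\pi^{(k)},t}(s,a)$, $\bar w_t(s,a)=\frac1K\sum_{j=1}^K w^{(j)}_t(s,a)$, $\eta^{(k)}_t(s,a)=w^{(k)}_t(s,a)/\bar w_t(s,a)$, $\underline\eta_t=\min_{k,s,a}\eta^{(k)}_t(s,a)$, $\overline\eta_t=\max_{k,s,a}\eta^{(k)}_t(s,a)$. *)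

theory Defs
  imports "HOL-Probability.Probability"
begin

record ('s, 'a) mdp =
  transition :: "'s \<Rightarrow> 'a \<Rightarrow> 's pmf"
  reward :: "'s \<Rightarrow> 'a \<Rightarrow> real"
  horizon :: nat

type_synonym ('s, 'a) policy = "nat \<Rightarrow> 's \<Rightarrow> 'a pmf"

text \<open>
  A segment generated from time \<open>t\<close> on is the list of the triples
  \<open>(S\<^sub>i, A\<^sub>i, R\<^sub>i\<^sub>+\<^sub>1)\<close> for \<open>i = t, t + 1, \<dots>\<close>; its entry number \<open>0\<close> belongs to time \<open>t\<close>.
\<close>

type_synonym ('s, 'a) segment = "('s \<times> 'a \<times> real) list"

primrec run :: "('s, 'a) mdp \<Rightarrow> ('s, 'a) policy \<Rightarrow> nat \<Rightarrow> nat \<Rightarrow> 's \<Rightarrow> ('s, 'a) segment pmf" where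
  "run M \<mu> 0 t s = return_pmf []"
| "run M \<mu> (Suc n) t s =
     do {
       a \<leftarrow> \<mu> t s;
       s' \<leftarrow> transition M s a;
       \<tau> \<leftarrow> run M \<mu> n (Suc t) s';
       return_pmf ((s, a, reward M s a) # \<tau>)
     }"

text \<open>The law of the segment from time \<open>t\<close> to \<open>T - 1\<close>, given \<open>S\<^sub>t = s\<close>.\<close>

definition traj :: "('s, 'a) mdp \<Rightarrow> ('s, 'a) policy \<Rightarrow> nat \<Rightarrow> 's \<Rightarrow> ('s, 'a) segment pmf" where
  "traj M \<mu> t s = run M \<mu> (horizon M - t) t s"

text \<open>The law of the same segment, given \<open>S\<^sub>t = s\<close> and \<open>A\<^sub>t = a\<close> (for \<open>t < T\<close>).\<close>

definition traj_sa :: "('s, 'a) mdp \<Rightarrow> ('s, 'a) policy \<Rightarrow> nat \<Rightarrow> 's \<Rightarrow> 'a \<Rightarrow> ('s, 'a) segment pmf" where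
  "traj_sa M \<mu> t s a =
     do {
       s' \<leftarrow> transition M s a;
       \<tau> \<leftarrow> traj M \<mu> (Suc t) s';
       return_pmf ((s, a, reward M s a) # \<tau>)
     }"

definition total_reward :: "('s, 'a) segment \<Rightarrow> real" where
  "total_reward \<tau> = (\<Sum>(_, _, R)\<leftarrow>\<tau>. R)"

definition v_val :: "('s, 'a) mdp \<Rightarrow> ('s, 'a) policy \<Rightarrow> nat \<Rightarrow> 's \<Rightarrow> real" where
  "v_val M \<pi> t s = measure_pmf.expectation (traj M \<pi> t s) total_reward"

definition q_val :: "('s, 'a) mdp \<Rightarrow> ('s, 'a) policy \<Rightarrow> nat \<Rightarrow> 's \<Rightarrow> 'a \<Rightarrow> real" where
  "q_val M \<pi> t s a = measure_pmf.expectation (traj_sa M \<pi> t s a) total_reward"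

definition ratio :: "('s, 'a) policy \<Rightarrow> ('s, 'a) policy \<Rightarrow> nat \<Rightarrow> 's \<Rightarrow> 'a \<Rightarrow> real" where
  "ratio \<pi> \<mu> j s a = pmf (\<pi> j s) a / pmf (\<mu> j s) a"

definition pdis :: "('s, 'a) policy \<Rightarrow> ('s, 'a) policy \<Rightarrow> nat \<Rightarrow> ('s, 'a) segment \<Rightarrow> real" where
  "pdis \<pi> \<mu> t \<tau> =
     (\<Sum>i\<in>{t..<t + length \<tau>}.
        (\<Prod>j\<in>{t..i}. case \<tau> ! (j - t) of (s, a, _) \<Rightarrow> ratio \<pi> \<mu> j s a) *
        (case \<tau> ! (i - t) of (_, _, R) \<Rightarrow> R))"

definition var_pdis :: "('s, 'a) mdp \<Rightarrow> ('s, 'a) policy \<Rightarrow> ('s, 'a) policy \<Rightarrow> nat \<Rightarrow> 's \<Rightarrow> real" where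
  "var_pdis M \<pi> \<mu> t s = measure_pmf.variance (traj M \<mu> t s) (pdis \<pi> \<mu> t)"

definition nu :: "('s, 'a) mdp \<Rightarrow> ('s, 'a) policy \<Rightarrow> nat \<Rightarrow> 's \<Rightarrow> 'a \<Rightarrow> real" where
  "nu M \<pi> t s a =
     (if Suc t < horizon M
      then measure_pmf.variance (transition M s a) (v_val M \<pi> (Suc t)) else 0)"

definition q_hat :: "('s::finite, 'a) mdp \<Rightarrow> ('s, 'a) policy \<Rightarrow> nat \<Rightarrow> 's \<Rightarrow> 'a \<Rightarrow> real" where
  "q_hat M \<pi> t s a =
     (if Suc t < horizon M
      then (q_val M \<pi> t s a)\<^sup>2 + nu M \<pi> t s a
           + (\<Sum>s'\<in>UNIV. pmf (transition M s a) s' * var_pdis M \<pi> \<pi> (Suc t) s')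
      else (q_val M \<pi> t s a)\<^sup>2)"

text \<open>
  The distribution proportional to a nonnegative \<open>f\<close>, uniform if \<open>f\<close> vanishes. The lemma below
  confirms that \<^const>\<open>embed_pmf\<close> is applied to a genuine probability mass function.
\<close>

definition pmf_proportional :: "('a::finite \<Rightarrow> real) \<Rightarrow> 'a pmf" where
  "pmf_proportional f =
     embed_pmf (\<lambda>a. if \<forall>b. f b = 0 then 1 / real CARD('a) else f a / (\<Sum>b\<in>UNIV. f b))"

lemma pmf_pmf_proportional:
  fixes f :: "'a::finite \<Rightarrow> real"
  assumes nonneg: "\<And>a. 0 \<le> f a"
  shows "pmf (pmf_proportional f) a =
           (if \<forall>b. f b = 0 then 1 / real CARD('a) else f a / (\<Sum>b\<in>UNIV. f b))"
proof -
  let ?g = "\<lambda>a. if \<forall>b. f b = 0 then 1 / real CARD('a) else f a / (\<Sum>b\<in>UNIV. f b)"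
  have nn: "0 \<le> ?g x" for x
    using nonneg by (auto intro!: divide_nonneg_nonneg sum_nonneg)
  have "(\<Sum>x\<in>UNIV. ?g x) = 1"
  proof (cases "\<forall>b. f b = 0")
    case True
    then show ?thesis by simp
  next
    case False
    then have "(\<Sum>b\<in>UNIV. f b) \<noteq> 0"
      using nonneg by (subst sum_nonneg_eq_0_iff) auto
    moreover have "(\<Sum>x\<in>UNIV. ?g x) = (\<Sum>x\<in>UNIV. f x / (\<Sum>b\<in>UNIV. f b))"
      using False by (intro sum.cong) auto
    ultimately show ?thesis by (simp flip: sum_divide_distrib)
  qed
  then have "(\<integral>\<^sup>+ x. ennreal (?g x) \<partial>count_space UNIV) = 1"
    using nn by (subst nn_integral_count_space_finite) (simp_all add: sum_ennreal)
  then show ?thesis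
    unfolding pmf_proportional_def using nn by (subst pmf_embed_pmf) auto
qed

text \<open>The target policies are \<open>\<pi> 1, \<dots>, \<pi> K\<close>.\<close>

definition mu_hat ::
    "('s::finite, 'a::finite) mdp \<Rightarrow> nat \<Rightarrow> (nat \<Rightarrow> ('s, 'a) policy) \<Rightarrow> ('s, 'a) policy" where
  "mu_hat M K \<pi> t s =
     pmf_proportional (\<lambda>a. sqrt (\<Sum>k\<in>{1..K}. (pmf (\<pi> k t s) a)\<^sup>2 * q_hat M (\<pi> k) t s a))"

definition weight :: "('s::finite, 'a) mdp \<Rightarrow> ('s, 'a) policy \<Rightarrow> nat \<Rightarrow> 's \<Rightarrow> 'a \<Rightarrow> real" where
  "weight M \<pi> t s a = (pmf (\<pi> t s) a)\<^sup>2 * q_hat M \<pi> t s a"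

definition w_bar ::
    "('s::finite, 'a) mdp \<Rightarrow> nat \<Rightarrow> (nat \<Rightarrow> ('s, 'a) policy) \<Rightarrow> nat \<Rightarrow> 's \<Rightarrow> 'a \<Rightarrow> real" where
  "w_bar M K \<pi> t s a = (1 / real K) * (\<Sum>j\<in>{1..K}. weight M (\<pi> j) t s a)"

text \<open>
  If \<^const>\<open>w_bar\<close> vanishes at \<open>(s, a)\<close>, then so does every weight, and the quotient
  is of the undefined form 0/0. Such pairs must not influence the minimum and the maximum below, so
  \<open>eta\<close> is set to \<open>1\<close> there: wherever the quotient is defined, its average over \<open>k\<close> is \<open>1\<close>,
  hence the minimum is at most \<open>1\<close> and the maximum at least \<open>1\<close> anyway. (The value \<open>0\<close> of HOL
  division would instead force the minimum to \<open>0\<close>.)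
\<close>

definition eta ::
    "('s::finite, 'a) mdp \<Rightarrow> nat \<Rightarrow> (nat \<Rightarrow> ('s, 'a) policy) \<Rightarrow> nat \<Rightarrow> nat \<Rightarrow> 's \<Rightarrow> 'a \<Rightarrow> real" where
  "eta M K \<pi> k t s a =
     (if w_bar M K \<pi> t s a = 0 then 1 else weight M (\<pi> k) t s a / w_bar M K \<pi> t s a)"

definition eta_min ::
    "('s::finite, 'a::finite) mdp \<Rightarrow> nat \<Rightarrow> (nat \<Rightarrow> ('s, 'a) policy) \<Rightarrow> nat \<Rightarrow> real" where
  "eta_min M K \<pi> t = Min ((\<lambda>(k, s, a). eta M K \<pi> k t s a) ` ({1..K} \<times> UNIV \<times> UNIV))"

definition eta_max ::
    "('s::finite, 'a::finite) mdp \<Rightarrow> nat \<Rightarrow> (nat \<Rightarrow> ('s, 'a) policy) \<Rightarrow> nat \<Rightarrow> real" where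
  "eta_max M K \<pi> t = Max ((\<lambda>(k, s, a). eta M K \<pi> k t s a) ` ({1..K} \<times> UNIV \<times> UNIV))"

text \<open>
  The square root of the quotient of the maximal by the minimal similarity. The maximum is positive,
  so the quotient is infinite if the minimum is \<open>0\<close>; real division would yield \<open>0\<close> and make the
  similarity condition void.
\<close>

definition sqrt_eta_quotient ::
    "('s::finite, 'a::finite) mdp \<Rightarrow> nat \<Rightarrow> (nat \<Rightarrow> ('s, 'a) policy) \<Rightarrow> nat \<Rightarrow> ereal" where
  "sqrt_eta_quotient M K \<pi> t =
     (if eta_min M K \<pi> t = 0 then \<infinity> else ereal (sqrt (eta_max M K \<pi> t / eta_min M K \<pi> t)))"

end

theory Submission
  imports Defs
begin

text \<open>
  Where \<open>\<mu>\<^sub>t(a|s)\<close> vanishes, \<open>\<pi>\<^sub>t(a|s)\<close> or \<open>q\<^sub>\<pi>\<^sub>,\<^sub>t(s, a)\<close> does, so the estimator is unbiased although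
  \<open>\<mu>\<close> need not cover \<open>\<pi>\<close>. Its second moment at \<open>s\<close> is therefore
  \<open>\<Sum>\<^sub>a (\<pi>\<^sup>2/\<mu>) (q\<^sup>2 + \<nu> + \<Sum>\<^sub>s\<^sub>' p V\<^sub>\<mu>(s'))\<close>, with \<open>V\<^sub>\<mu>\<close> the variance one step later. By backward
  induction \<open>V\<^sub>\<mu> \<le> V\<^sub>\<pi>\<close>, which bounds the second moment by \<open>\<Sum>\<^sub>a w/\<mu>\<close>, where \<open>w = \<pi>\<^sup>2 q_hat\<close>. Since \<open>\<mu>\<close> is
  proportional to the root of the mean weight, and \<open>w\<close> lies between \<open>eta_min\<close> and \<open>eta_max\<close> times
  that mean, \<open>\<Sum>\<^sub>a w/\<mu>\<close> is at most \<open>sqrt (eta_max/eta_min) (\<Sum>\<^sub>a sqrt w)\<^sup>2\<close>. By the similarity condition this is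
  at most \<open>\<Sum>\<^sub>a \<pi> q_hat\<close>, the second moment of the on-policy estimator.
\<close>

section \<open>Moments of the estimator\<close>

lemma finite_set_pmf_run:
  "finite (set_pmf (run (M :: ('s::finite, 'a::finite) mdp) \<mu> n t s))"
  by (induction n arbitrary: t s) auto

lemma finite_set_pmf_traj:
  "finite (set_pmf (traj (M :: ('s::finite, 'a::finite) mdp) \<mu> t s))"
  by (simp add: traj_def finite_set_pmf_run)

lemma traj_horizon: "horizon M \<le> t \<Longrightarrow> traj M \<mu> t s = return_pmf []"
  by (simp add: traj_def)

lemma traj_step:
  assumes "t < horizon M"
  shows "traj M \<mu> t s = \<mu> t s \<bind> traj_sa M \<mu> t s"
proof -
  have "horizon M - t = Suc (horizon M - Suc t)" using assms by simp
  then show ?thesis by (simp add: traj_def traj_sa_def[abs_def])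
qed

lemma finite_set_pmf_traj_sa:
  "finite (set_pmf (traj_sa (M :: ('s::finite, 'a::finite) mdp) \<mu> t s a))"
  by (simp add: traj_sa_def finite_set_pmf_traj)

lemma expectation_traj_sa:
  fixes M :: "('s::finite, 'a::finite) mdp" and f :: "_ \<Rightarrow> real"
  shows "measure_pmf.expectation (traj_sa M \<mu> t s a) f =
    (\<Sum>s'\<in>UNIV. pmf (transition M s a) s' *
       measure_pmf.expectation (traj M \<mu> (Suc t) s') (\<lambda>\<tau>. f ((s, a, reward M s a) # \<tau>)))"
  unfolding traj_sa_def map_pmf_def[symmetric]
  by (subst pmf_expectation_bind[where A = UNIV]) (auto simp: finite_set_pmf_traj)

lemma expectation_traj:
  fixes M :: "('s::finite, 'a::finite) mdp" and f :: "_ \<Rightarrow> real"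
  assumes "t < horizon M"
  shows "measure_pmf.expectation (traj M \<mu> t s) f =
    (\<Sum>a\<in>UNIV. pmf (\<mu> t s) a * measure_pmf.expectation (traj_sa M \<mu> t s a) f)"
  unfolding traj_step[OF assms]
  by (subst pmf_expectation_bind[where A = UNIV]) (auto simp: finite_set_pmf_traj_sa)

lemma integrable_traj:
  fixes M :: "('s::finite, 'a::finite) mdp" and f :: "_ \<Rightarrow> real"
  shows "integrable (measure_pmf (traj M \<mu> t s)) f"
  by (rule integrable_measure_pmf_finite) (rule finite_set_pmf_traj)

lemma v_val_horizon: "horizon M \<le> t \<Longrightarrow> v_val M \<pi> t s = 0"
  by (simp add: v_val_def traj_horizon total_reward_def)

lemma v_val_eq:
  fixes M :: "('s::finite, 'a::finite) mdp"
  assumes "t < horizon M"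
  shows "v_val M \<pi> t s = (\<Sum>a\<in>UNIV. pmf (\<pi> t s) a * q_val M \<pi> t s a)"
  unfolding v_val_def q_val_def by (rule expectation_traj[OF assms])

lemma sum_pmf_UNIV: "(\<Sum>x\<in>UNIV. pmf (p :: 'b::finite pmf) x) = 1"
  by (rule sum_pmf_eq_1) auto

lemma q_val_eq:
  fixes M :: "('s::finite, 'a::finite) mdp"
  shows "q_val M \<pi> t s a =
    reward M s a + (\<Sum>s'\<in>UNIV. pmf (transition M s a) s' * v_val M \<pi> (Suc t) s')"
proof -
  have "total_reward ((s, a, r) # \<tau>) = r + total_reward \<tau>" for s :: 's and a :: 'a and r \<tau>
    by (simp add: total_reward_def)
  then have "q_val M \<pi> t s a = (\<Sum>s'\<in>UNIV. pmf (transition M s a) s' *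
      (reward M s a + v_val M \<pi> (Suc t) s'))"
    by (simp add: q_val_def expectation_traj_sa v_val_def Bochner_Integration.integral_add
        integrable_traj)
  then show ?thesis
    by (simp add: distrib_left sum.distrib sum_pmf_UNIV flip: sum_distrib_right)
qed

section \<open>Recursion, mean and second moment of the PDIS estimator\<close>

lemma pdis_Nil: "pdis \<pi> \<mu> t [] = 0"
  by (simp add: pdis_def)

text \<open>Every product of ratios starts at time \<open>t\<close>, so the first ratio is a common
  factor. This recursion lets all moments be computed one time step at a time.\<close>

lemma pdis_Cons:
  "pdis \<pi> \<mu> t ((s, a, r) # \<tau>) = ratio \<pi> \<mu> t s a * (r + pdis \<pi> \<mu> (Suc t) \<tau>)"
proof -
  let ?\<rho> = "\<lambda>t \<tau> j. case \<tau> ! (j - t) of (s, a, _) \<Rightarrow> ratio \<pi> \<mu> j s a"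
  let ?R = "\<lambda>t \<tau> i. case \<tau> ! (i - t) of (_, _, R) \<Rightarrow> R"
  let ?\<sigma> = "(s, a, r) # \<tau>"
  \<comment> \<open>Removing the head and starting one step later keep the entry that belongs to a
    given time; the bound on \<open>i\<close> keeps the natural subtraction exact.\<close>
  have shift: "?\<sigma> ! (i - t) = \<tau> ! (i - Suc t)" if "Suc t \<le> i" for i
  proof -
    have "i - t = Suc (i - Suc t)" using that by simp
    then show ?thesis by simp
  qed
  have prod: "(\<Prod>j\<in>{t..i}. ?\<rho> t ?\<sigma> j) = ratio \<pi> \<mu> t s a * (\<Prod>j\<in>{Suc t..i}. ?\<rho> (Suc t) \<tau> j)"
    if "t \<le> i" for i
  proof -
    have "(\<Prod>j\<in>{t..i}. ?\<rho> t ?\<sigma> j) = ratio \<pi> \<mu> t s a * (\<Prod>j\<in>{Suc t..i}. ?\<rho> t ?\<sigma> j)"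
      using that by (subst prod.atLeast_Suc_atMost) auto
    also have "(\<Prod>j\<in>{Suc t..i}. ?\<rho> t ?\<sigma> j) = (\<Prod>j\<in>{Suc t..i}. ?\<rho> (Suc t) \<tau> j)"
      by (intro prod.cong refl) (simp only: shift atLeastAtMost_iff)
    finally show ?thesis .
  qed
  have "pdis \<pi> \<mu> t ?\<sigma> = (\<Sum>i\<in>{t..<Suc (t + length \<tau>)}. (\<Prod>j\<in>{t..i}. ?\<rho> t ?\<sigma> j) * ?R t ?\<sigma> i)"
    by (simp add: pdis_def)
  also have "\<dots> = ratio \<pi> \<mu> t s a * r +
      (\<Sum>i\<in>{Suc t..<Suc (t + length \<tau>)}. (\<Prod>j\<in>{t..i}. ?\<rho> t ?\<sigma> j) * ?R t ?\<sigma> i)"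
    by (subst sum.atLeast_Suc_lessThan) auto
  also have "(\<Sum>i\<in>{Suc t..<Suc (t + length \<tau>)}. (\<Prod>j\<in>{t..i}. ?\<rho> t ?\<sigma> j) * ?R t ?\<sigma> i) =
      (\<Sum>i\<in>{Suc t..<Suc (t + length \<tau>)}.
        ratio \<pi> \<mu> t s a * ((\<Prod>j\<in>{Suc t..i}. ?\<rho> (Suc t) \<tau> j) * ?R (Suc t) \<tau> i))"
    by (intro sum.cong refl) (simp only: prod shift atLeastLessThan_iff Suc_leD mult.assoc)
  also have "\<dots> = ratio \<pi> \<mu> t s a * pdis \<pi> \<mu> (Suc t) \<tau>"
    by (simp add: pdis_def flip: sum_distrib_left)
  finally show ?thesis by (simp add: distrib_left)
qed

lemma expectation_pdis_unbiased:
  fixes M :: "('s::finite, 'a::finite) mdp"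
  assumes cover: "\<And>t s a. t < horizon M \<Longrightarrow> pmf (\<mu> t s) a = 0 \<Longrightarrow>
    pmf (\<pi> t s) a * q_val M \<pi> t s a = 0"
  shows "measure_pmf.expectation (traj M \<mu> t s) (pdis \<pi> \<mu> t) = v_val M \<pi> t s"
proof (induction "horizon M - t" arbitrary: t s)
  case 0
  then show ?case by (simp add: traj_horizon pdis_Nil v_val_horizon)
next
  case (Suc n)
  then have t: "t < horizon M" and n: "n = horizon M - Suc t" by auto
  have "measure_pmf.expectation (traj_sa M \<mu> t s a) (pdis \<pi> \<mu> t) =
      ratio \<pi> \<mu> t s a * q_val M \<pi> t s a" for a
  proof -
    have "measure_pmf.expectation (traj_sa M \<mu> t s a) (pdis \<pi> \<mu> t) =
      (\<Sum>s'\<in>UNIV. pmf (transition M s a) s' *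
        (ratio \<pi> \<mu> t s a * (reward M s a + v_val M \<pi> (Suc t) s')))"
      by (simp add: expectation_traj_sa pdis_Cons Suc.hyps(1)[OF n] Bochner_Integration.integral_add
        integrable_traj)
    also have "\<dots> = ratio \<pi> \<mu> t s a * (\<Sum>s'\<in>UNIV. pmf (transition M s a) s' *
        (reward M s a + v_val M \<pi> (Suc t) s'))"
      by (simp add: sum_distrib_left mult.left_commute)
    finally show ?thesis
      by (simp add: q_val_eq distrib_left sum.distrib sum_pmf_UNIV flip: sum_distrib_right)
  qed
  then have "measure_pmf.expectation (traj M \<mu> t s) (pdis \<pi> \<mu> t) =
      (\<Sum>a\<in>UNIV. pmf (\<mu> t s) a * (ratio \<pi> \<mu> t s a * q_val M \<pi> t s a))"
    by (simp add: expectation_traj[OF t])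
  \<comment> \<open>Where \<mu> vanishes, the left term is 0, and \<open>cover\<close> says that the
    right term it should produce is 0 as well. Elsewhere \<mu> cancels.\<close>
  also have "\<dots> = (\<Sum>a\<in>UNIV. pmf (\<pi> t s) a * q_val M \<pi> t s a)"
    using cover[OF t] by (intro sum.cong refl) (auto simp: ratio_def)
  finally show ?case by (simp add: v_val_eq[OF t])
qed

lemma pmf_variance_eq:
  fixes f :: "'b \<Rightarrow> real"
  assumes "finite (set_pmf p)"
  shows "measure_pmf.variance p f =
    measure_pmf.expectation p (\<lambda>x. (f x)\<^sup>2) - (measure_pmf.expectation p f)\<^sup>2"
  by (rule measure_pmf.variance_eq) (simp_all add: integrable_measure_pmf_finite assms)

text \<open>Law of total variance: given the next state s', the reward plus the remaining estimator
  has mean r + v(s') and variance \<open>var_pdis\<close> at s'. Averaging (r + v)^2 over s' yields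
  q^2 plus the variance of v.\<close>

lemma second_moment_pdis:
  fixes M :: "('s::finite, 'a::finite) mdp"
  assumes cover: "\<And>t s a. t < horizon M \<Longrightarrow> pmf (\<mu> t s) a = 0 \<Longrightarrow>
    pmf (\<pi> t s) a * q_val M \<pi> t s a = 0"
    and t: "t < horizon M"
  shows "measure_pmf.expectation (traj M \<mu> t s) (\<lambda>\<tau>. (pdis \<pi> \<mu> t \<tau>)\<^sup>2) =
    (\<Sum>a\<in>UNIV. (pmf (\<pi> t s) a)\<^sup>2 / pmf (\<mu> t s) a *
      ((q_val M \<pi> t s a)\<^sup>2 + measure_pmf.variance (transition M s a) (v_val M \<pi> (Suc t)) +
       (\<Sum>s'\<in>UNIV. pmf (transition M s a) s' * var_pdis M \<pi> \<mu> (Suc t) s')))"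
proof -
  have "measure_pmf.expectation (traj_sa M \<mu> t s a) (\<lambda>\<tau>. (pdis \<pi> \<mu> t \<tau>)\<^sup>2) =
      (ratio \<pi> \<mu> t s a)\<^sup>2 *
      ((q_val M \<pi> t s a)\<^sup>2 + measure_pmf.variance (transition M s a) (v_val M \<pi> (Suc t)) +
       (\<Sum>s'\<in>UNIV. pmf (transition M s a) s' * var_pdis M \<pi> \<mu> (Suc t) s'))" for a
  proof -
    let ?p = "pmf (transition M s a)" and ?r = "reward M s a" and ?c = "ratio \<pi> \<mu> t s a"
    let ?v = "v_val M \<pi> (Suc t)" and ?V = "var_pdis M \<pi> \<mu> (Suc t)"
    let ?E = "\<lambda>s'. measure_pmf.expectation (traj M \<mu> (Suc t) s')"
    have "?E s' (\<lambda>\<tau>. (?c * (?r + pdis \<pi> \<mu> (Suc t) \<tau>))\<^sup>2) =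
        ?c\<^sup>2 * ((?r\<^sup>2 + 2 * ?r * ?v s' + (?v s')\<^sup>2) + ?V s')" for s'
    proof -
      have "?E s' (\<lambda>\<tau>. (?c * (?r + pdis \<pi> \<mu> (Suc t) \<tau>))\<^sup>2) =
          ?E s' (\<lambda>\<tau>. ?c\<^sup>2 * (?r\<^sup>2 + 2 * ?r * pdis \<pi> \<mu> (Suc t) \<tau> + (pdis \<pi> \<mu> (Suc t) \<tau>)\<^sup>2))"
        by (simp add: power2_eq_square algebra_simps)
      also have "\<dots> = ?c\<^sup>2 * (?r\<^sup>2 + 2 * ?r * ?E s' (pdis \<pi> \<mu> (Suc t)) +
          ?E s' (\<lambda>\<tau>. (pdis \<pi> \<mu> (Suc t) \<tau>)\<^sup>2))"
        by (simp add: Bochner_Integration.integral_add integrable_traj)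
      also have "?E s' (\<lambda>\<tau>. (pdis \<pi> \<mu> (Suc t) \<tau>)\<^sup>2) = (?v s')\<^sup>2 + ?V s'"
        unfolding var_pdis_def pmf_variance_eq[OF finite_set_pmf_traj]
        by (simp add: expectation_pdis_unbiased[OF cover])
      finally show ?thesis by (simp add: expectation_pdis_unbiased[OF cover] add.assoc)
    qed
    then have "measure_pmf.expectation (traj_sa M \<mu> t s a) (\<lambda>\<tau>. (pdis \<pi> \<mu> t \<tau>)\<^sup>2) =
        (\<Sum>s'\<in>UNIV. ?p s' * (?c\<^sup>2 * ((?r\<^sup>2 + 2 * ?r * ?v s' + (?v s')\<^sup>2) + ?V s')))"
      by (simp add: expectation_traj_sa pdis_Cons)
    also have "\<dots> = ?c\<^sup>2 * ((\<Sum>s'\<in>UNIV. ?p s') * ?r\<^sup>2 + 2 * ?r * (\<Sum>s'\<in>UNIV. ?p s' * ?v s') +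
        (\<Sum>s'\<in>UNIV. ?p s' * (?v s')\<^sup>2) + (\<Sum>s'\<in>UNIV. ?p s' * ?V s'))"
      by (simp add: sum_distrib_left sum_distrib_right algebra_simps flip: sum.distrib)
    \<comment> \<open>The squared mean split off here completes r^2 + 2 r E[v] to the square of
      \<open>q_val\<close>.\<close>
    also have "(\<Sum>s'\<in>UNIV. ?p s' * (?v s')\<^sup>2) =
        measure_pmf.variance (transition M s a) ?v + (\<Sum>s'\<in>UNIV. ?p s' * ?v s')\<^sup>2"
      unfolding pmf_variance_eq[OF finite]
      by (simp add: integral_measure_pmf_real[where A = UNIV] mult.commute)
    finally show ?thesis
      by (simp add: sum_pmf_UNIV q_val_eq power2_sum algebra_simps)
  qed
  \<comment> \<open>This covers x = 0 too: both sides are then 0.\<close>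
  moreover have "x * ((y / x)\<^sup>2 * z) = y\<^sup>2 / x * z" for x y z :: real
    by (simp add: power2_eq_square)
  ultimately show ?thesis
    by (simp add: expectation_traj[OF t] ratio_def)
qed

lemma var_pdis_horizon: "horizon M \<le> t \<Longrightarrow> var_pdis M \<pi> \<mu> t s = 0"
  by (simp add: var_pdis_def traj_horizon)

lemma var_pdis_nonneg: "0 \<le> var_pdis M \<pi> \<mu> t s"
  by (simp add: var_pdis_def)

text \<open>The case distinction in the definition is redundant, as nothing remains at the horizon.\<close>

lemma q_hat_eq:
  fixes M :: "('s::finite, 'a::finite) mdp"
  shows "q_hat M \<pi> t s a =
    (q_val M \<pi> t s a)\<^sup>2 + measure_pmf.variance (transition M s a) (v_val M \<pi> (Suc t)) +
    (\<Sum>s'\<in>UNIV. pmf (transition M s a) s' * var_pdis M \<pi> \<pi> (Suc t) s')"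
proof -
  have "v_val M \<pi> (Suc t) = (\<lambda>_. 0)" if "\<not> Suc t < horizon M"
    using that by (simp add: v_val_horizon fun_eq_iff)
  then show ?thesis by (simp add: q_hat_def nu_def var_pdis_horizon)
qed

lemma q_val_sq_le_q_hat:
  fixes M :: "('s::finite, 'a::finite) mdp"
  shows "(q_val M \<pi> t s a)\<^sup>2 \<le> q_hat M \<pi> t s a"
  unfolding q_hat_eq by (simp add: add_nonneg_nonneg sum_nonneg var_pdis_nonneg)

lemma q_hat_nonneg:
  fixes M :: "('s::finite, 'a::finite) mdp"
  shows "0 \<le> q_hat M \<pi> t s a"
  using q_val_sq_le_q_hat by (rule order_trans[OF zero_le_power2])

section \<open>Variance on and off policy\<close>

lemma var_pdis_eq:
  fixes M :: "('s::finite, 'a::finite) mdp"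
  assumes cover: "\<And>t s a. t < horizon M \<Longrightarrow> pmf (\<mu> t s) a = 0 \<Longrightarrow>
    pmf (\<pi> t s) a * q_val M \<pi> t s a = 0"
  shows "var_pdis M \<pi> \<mu> t s =
    measure_pmf.expectation (traj M \<mu> t s) (\<lambda>\<tau>. (pdis \<pi> \<mu> t \<tau>)\<^sup>2) - (v_val M \<pi> t s)\<^sup>2"
  unfolding var_pdis_def pmf_variance_eq[OF finite_set_pmf_traj]
  by (simp add: expectation_pdis_unbiased[OF cover])

text \<open>For \<mu> = \<pi> coverage is trivial, the coefficient \<pi>^2/\<mu> is \<pi>, and the
  bracket in the second moment is exactly \<open>q_hat\<close>.\<close>

lemma var_pdis_on_policy:
  fixes M :: "('s::finite, 'a::finite) mdp"
  assumes t: "t < horizon M"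
  shows "var_pdis M \<pi> \<pi> t s =
    (\<Sum>a\<in>UNIV. pmf (\<pi> t s) a * q_hat M \<pi> t s a) - (v_val M \<pi> t s)\<^sup>2"
  by (subst var_pdis_eq; (subst second_moment_pdis[OF _ t])?)
    (auto simp: q_hat_eq power2_eq_square)

text \<open>Inside the bracket of the second moment, \<mu> enters only through the variance one step
  later, and with nonnegative coefficients. Raising that variance to its on-policy value turns the
  bracket into \<open>q_hat\<close>.\<close>

lemma var_pdis_off_policy_le:
  fixes M :: "('s::finite, 'a::finite) mdp"
  assumes cover: "\<And>t s a. t < horizon M \<Longrightarrow> pmf (\<mu> t s) a = 0 \<Longrightarrow>
    pmf (\<pi> t s) a * q_val M \<pi> t s a = 0"
    and t: "t < horizon M"
    and le: "\<And>s. var_pdis M \<pi> \<mu> (Suc t) s \<le> var_pdis M \<pi> \<pi> (Suc t) s"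
  shows "var_pdis M \<pi> \<mu> t s \<le>
    (\<Sum>a\<in>UNIV. weight M \<pi> t s a / pmf (\<mu> t s) a) - (v_val M \<pi> t s)\<^sup>2"
proof -
  let ?b = "\<lambda>a. (q_val M \<pi> t s a)\<^sup>2 + measure_pmf.variance (transition M s a) (v_val M \<pi> (Suc t))"
  have "var_pdis M \<pi> \<mu> t s =
      measure_pmf.expectation (traj M \<mu> t s) (\<lambda>\<tau>. (pdis \<pi> \<mu> t \<tau>)\<^sup>2) - (v_val M \<pi> t s)\<^sup>2"
    by (rule var_pdis_eq) (rule cover)
  also have "measure_pmf.expectation (traj M \<mu> t s) (\<lambda>\<tau>. (pdis \<pi> \<mu> t \<tau>)\<^sup>2) =
      (\<Sum>a\<in>UNIV. (pmf (\<pi> t s) a)\<^sup>2 / pmf (\<mu> t s) a *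
        (?b a + (\<Sum>s'\<in>UNIV. pmf (transition M s a) s' * var_pdis M \<pi> \<mu> (Suc t) s')))"
    by (rule second_moment_pdis[OF _ t]) (rule cover)
  also have "\<dots> \<le> (\<Sum>a\<in>UNIV. (pmf (\<pi> t s) a)\<^sup>2 / pmf (\<mu> t s) a * q_hat M \<pi> t s a)"
    unfolding q_hat_eq by (intro sum_mono mult_left_mono add_left_mono le) simp_all
  also have "\<dots> = (\<Sum>a\<in>UNIV. weight M \<pi> t s a / pmf (\<mu> t s) a)"
    by (simp add: weight_def)
  finally show ?thesis by simp
qed

section \<open>The similarity condition\<close>

text \<open>With f the unnormalized behavior policy, the left side is the sum of w/\<mu>. The upper
  bound controls w/f and the lower bound controls f, each by a multiple of sqrt w.\<close>

lemma sum_div_times_sum_le: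
  fixes w f :: "'b \<Rightarrow> real"
  assumes w: "\<And>a. 0 \<le> w a" and f: "\<And>a. 0 \<le> f a" and l: "0 < l"
    and lower: "\<And>a. l * (f a)\<^sup>2 \<le> w a" and upper: "\<And>a. w a \<le> u * (f a)\<^sup>2"
  shows "(\<Sum>a\<in>A. w a / f a) * (\<Sum>a\<in>A. f a) \<le> sqrt (u / l) * (\<Sum>a\<in>A. sqrt (w a))\<^sup>2"
proof -
  have "w a / f a \<le> sqrt u * sqrt (w a)" for a
  proof (cases "f a = 0")
    case True
    \<comment> \<open>The upper bound forces w to vanish here, so both sides are 0 whatever the sign
      of u.\<close>
    then show ?thesis using upper[of a] w[of a] by simp
  next
    case False
    have "sqrt (w a) \<le> sqrt u * f a"
      using real_sqrt_le_mono[OF upper[of a]] f[of a] by (simp add: real_sqrt_mult)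
    then have "sqrt (w a) * sqrt (w a) \<le> sqrt u * f a * sqrt (w a)"
      by (rule mult_right_mono) (simp add: w)
    then show ?thesis
      using False f[of a] w[of a] by (simp add: divide_le_eq mult_ac)
  qed
  then have 1: "(\<Sum>a\<in>A. w a / f a) \<le> sqrt u * (\<Sum>a\<in>A. sqrt (w a))"
    by (simp add: sum_distrib_left sum_mono)
  have "f a \<le> sqrt (w a) / sqrt l" for a
    using real_sqrt_le_mono[OF lower[of a]] f[of a] l
    by (simp add: real_sqrt_mult le_divide_eq mult.commute)
  then have 2: "(\<Sum>a\<in>A. f a) \<le> (\<Sum>a\<in>A. sqrt (w a)) / sqrt l"
    by (simp add: sum_divide_distrib sum_mono)
  have "(\<Sum>a\<in>A. w a / f a) * (\<Sum>a\<in>A. f a) \<le>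
      (sqrt u * (\<Sum>a\<in>A. sqrt (w a))) * ((\<Sum>a\<in>A. sqrt (w a)) / sqrt l)"
    by (rule mult_mono'[OF 1 2]) (simp_all add: w f sum_nonneg)
  then show ?thesis
    by (simp add: real_sqrt_divide power2_eq_square)
qed

lemma pmf_proportional_eq_0D:
  fixes f :: "'a::finite \<Rightarrow> real"
  assumes f: "\<And>a. 0 \<le> f a" and 0: "pmf (pmf_proportional f) a = 0"
  shows "f a = 0"
proof (cases "\<forall>b. f b = 0")
  case False
  then have "(\<Sum>b\<in>UNIV. f b) \<noteq> 0"
    using f by (subst sum_nonneg_eq_0_iff) auto
  then show ?thesis
    using 0 False by (auto simp: pmf_pmf_proportional[OF f])
qed blast

text \<open>Dividing by a normalized f multiplies by its total mass. If f vanishes identically, the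
  pmf is uniform while the right side is 0; the assumption on w then makes the left side 0.\<close>

lemma sum_div_pmf_proportional:
  fixes w f :: "'a::finite \<Rightarrow> real"
  assumes f: "\<And>a. 0 \<le> f a" and w: "\<And>a. f a = 0 \<Longrightarrow> w a = 0"
  shows "(\<Sum>a\<in>UNIV. w a / pmf (pmf_proportional f) a) = (\<Sum>a\<in>UNIV. w a / f a) * (\<Sum>a\<in>UNIV. f a)"
proof (cases "\<forall>a. f a = 0")
  case True
  then show ?thesis by (simp add: w)
next
  case False
  then show ?thesis
    unfolding pmf_pmf_proportional[OF f] by (simp only: if_False sum_distrib_right) simp
qed

section \<open>Weights, coverage by \<open>mu_hat\<close>, and similarity\<close>

lemma weight_nonneg:
  fixes M :: "('s::finite, 'a::finite) mdp"
  shows "0 \<le> weight M \<pi> t s a"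
  by (simp add: weight_def q_hat_nonneg)

lemma weight_le_sum:
  fixes M :: "('s::finite, 'a::finite) mdp" and K :: nat
  assumes "k \<in> {1..K}"
  shows "weight M (\<pi> k) t s a \<le> (\<Sum>j\<in>{1..K}. weight M (\<pi> j) t s a)"
  using assms by (intro member_le_sum) (auto simp: weight_nonneg)

lemma mu_hat_eq:
  "mu_hat M K \<pi> t s = pmf_proportional (\<lambda>a. sqrt (\<Sum>j\<in>{1..K}. weight M (\<pi> j) t s a))"
  by (simp add: mu_hat_def weight_def)

lemma weight_eq_0_if_mu_hat_eq_0:
  fixes M :: "('s::finite, 'a::finite) mdp"
  assumes k: "k \<in> {1..K}" and 0: "pmf (mu_hat M K \<pi> t s) a = 0"
  shows "weight M (\<pi> k) t s a = 0"
proof -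
  have "sqrt (\<Sum>j\<in>{1..K}. weight M (\<pi> j) t s a) = 0"
    using 0 unfolding mu_hat_eq
    by (rule pmf_proportional_eq_0D[rotated]) (simp add: sum_nonneg weight_nonneg)
  then show ?thesis
    using weight_le_sum[OF k, of M \<pi> t s a] weight_nonneg[of M "\<pi> k" t s a] by simp
qed

text \<open>A vanishing weight means that \<pi> or \<open>q_hat\<close> is 0, and
  \<open>q_hat\<close> dominates the square of \<open>q_val\<close>.\<close>

lemma mu_hat_cover:
  fixes M :: "('s::finite, 'a::finite) mdp"
  assumes "k \<in> {1..K}" and "pmf (mu_hat M K \<pi> t s) a = 0"
  shows "pmf (\<pi> k t s) a * q_val M (\<pi> k) t s a = 0"
  using weight_eq_0_if_mu_hat_eq_0[OF assms] q_val_sq_le_q_hat[of M "\<pi> k" t s a]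
  by (auto simp: weight_def)

lemma eta_bounds:
  fixes M :: "('s::finite, 'a::finite) mdp"
  assumes "k \<in> {1..K}"
  shows "eta_min M K \<pi> t \<le> eta M K \<pi> k t s a" and "eta M K \<pi> k t s a \<le> eta_max M K \<pi> t"
proof -
  have "eta M K \<pi> k t s a \<in> (\<lambda>(k, s, a). eta M K \<pi> k t s a) ` ({1..K} \<times> UNIV \<times> UNIV)"
    using assms by (intro image_eqI[where x = "(k, s, a)"]) auto
  then show "eta_min M K \<pi> t \<le> eta M K \<pi> k t s a" and "eta M K \<pi> k t s a \<le> eta_max M K \<pi> t"
    by (simp_all only: eta_min_def eta_max_def Min_le Max_ge finite_imageI finite_cartesian_product
        finite_atLeastAtMost finite)
qed

lemma eta_nonneg:
  fixes M :: "('s::finite, 'a::finite) mdp"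
  shows "0 \<le> eta M K \<pi> k t s a"
  by (simp add: eta_def w_bar_def weight_nonneg sum_nonneg)

lemma eta_min_nonneg:
  fixes M :: "('s::finite, 'a::finite) mdp"
  assumes "k \<in> {1..K}"
  shows "0 \<le> eta_min M K \<pi> t"
  unfolding eta_min_def using assms by (subst Min_ge_iff) (auto simp: eta_nonneg)

text \<open>The default value of \<open>eta\<close> does no harm: where \<open>w_bar\<close> is 0,
  the nonnegative weights all vanish and both sides are 0.\<close>

lemma weight_eq_eta:
  fixes M :: "('s::finite, 'a::finite) mdp"
  assumes k: "k \<in> {1..K}"
  shows "weight M (\<pi> k) t s a = eta M K \<pi> k t s a / K * (\<Sum>j\<in>{1..K}. weight M (\<pi> j) t s a)"
  using weight_le_sum[OF k, of M \<pi> t s a] weight_nonneg[of M "\<pi> k" t s a] k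
  by (auto simp: eta_def w_bar_def)

lemma sum_weight_div_mu_hat_le:
  fixes M :: "('s::finite, 'a::finite) mdp"
  assumes k: "k \<in> {1..K}"
    and sim: "sqrt_eta_quotient M K \<pi> t *
         ereal ((\<Sum>a\<in>UNIV. pmf (\<pi> k t s) a * sqrt (q_hat M (\<pi> k) t s a))\<^sup>2)
       \<le> ereal (\<Sum>a\<in>UNIV. pmf (\<pi> k t s) a * q_hat M (\<pi> k) t s a)"
  shows "(\<Sum>a\<in>UNIV. weight M (\<pi> k) t s a / pmf (mu_hat M K \<pi> t s) a)
    \<le> (\<Sum>a\<in>UNIV. pmf (\<pi> k t s) a * q_hat M (\<pi> k) t s a)"
proof -
  let ?w = "weight M (\<pi> k) t s" and ?W = "\<lambda>a. \<Sum>j\<in>{1..K}. weight M (\<pi> j) t s a"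
  have sqrt_w: "pmf (\<pi> k t s) a * sqrt (q_hat M (\<pi> k) t s a) = sqrt (?w a)" for a
    by (simp add: weight_def real_sqrt_mult)
  have W: "0 \<le> ?W a" for a by (simp add: sum_nonneg weight_nonneg)
  have w0: "?w a = 0" if "sqrt (?W a) = 0" for a
    using that weight_le_sum[OF k, of M \<pi> t s a] weight_nonneg[of M "\<pi> k" t s a] by simp
  show ?thesis
  proof (cases "eta_min M K \<pi> t = 0")
    case True
    \<comment> \<open>The quotient is infinite while the right side of \<open>sim\<close> is finite,
      so the squared factor must be 0; all weights of policy k at s then vanish.\<close>
    have "(\<Sum>a\<in>UNIV. sqrt (?w a)) = 0"
    proof (rule ccontr)
      assume "(\<Sum>a\<in>UNIV. sqrt (?w a)) \<noteq> 0"
      then have "(0::ereal) < ereal ((\<Sum>a\<in>UNIV. sqrt (?w a))\<^sup>2)" by simp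
      then show False using sim True by (simp add: sqrt_eta_quotient_def sqrt_w)
    qed
    then have "?w a = 0" for a
      by (simp add: sum_nonneg_eq_0_iff weight_nonneg)
    then show ?thesis by (simp add: sum_nonneg q_hat_nonneg)
  next
    case False
    \<comment> \<open>The similarities compare with the mean weight, but \<open>mu_hat\<close> uses
      the sum, hence the division by K; it cancels in the quotient.\<close>
    let ?l = "eta_min M K \<pi> t / K" and ?u = "eta_max M K \<pi> t / K"
    have K: "0 < real K" using k by simp
    have l: "0 < ?l"
      using False eta_min_nonneg[OF k, of M \<pi> t] K by simp
    have "(\<Sum>a\<in>UNIV. ?w a / pmf (mu_hat M K \<pi> t s) a) =
        (\<Sum>a\<in>UNIV. ?w a / sqrt (?W a)) * (\<Sum>a\<in>UNIV. sqrt (?W a))"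
      unfolding mu_hat_eq
      by (rule sum_div_pmf_proportional) (simp_all only: real_sqrt_ge_0_iff W w0)
    also have "\<dots> \<le> sqrt (?u / ?l) * (\<Sum>a\<in>UNIV. sqrt (?w a))\<^sup>2"
    proof (rule sum_div_times_sum_le[OF _ _ l])
      fix a
      show "?l * (sqrt (?W a))\<^sup>2 \<le> ?w a" and "?w a \<le> ?u * (sqrt (?W a))\<^sup>2"
        using eta_bounds[OF k, of M \<pi> t s a] W[of a] K
        unfolding weight_eq_eta[OF k, of M \<pi> t s a] real_sqrt_pow2[OF W]
        by (auto intro!: mult_right_mono divide_right_mono)
    qed (simp_all add: weight_nonneg sum_nonneg)
    also have "?u / ?l = eta_max M K \<pi> t / eta_min M K \<pi> t"
      using K by simp
    finally show ?thesis
      using sim False by (simp add: sqrt_eta_quotient_def sqrt_w)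
  qed
qed

theorem theorem4:
  fixes M :: "('s::finite, 'a::finite) mdp"
    and K :: nat
    and \<pi> :: "nat \<Rightarrow> ('s, 'a) policy"
  assumes similarity:
    "\<forall>k\<in>{1..K}. \<forall>t<horizon M. \<forall>s.
       sqrt_eta_quotient M K \<pi> t *
         ereal ((\<Sum>a\<in>UNIV. pmf (\<pi> k t s) a * sqrt (q_hat M (\<pi> k) t s a))\<^sup>2)
       \<le> ereal (\<Sum>a\<in>UNIV. pmf (\<pi> k t s) a * q_hat M (\<pi> k) t s a)"
  shows "\<forall>k\<in>{1..K}. \<forall>t<horizon M. \<forall>s.
           var_pdis M (\<pi> k) (mu_hat M K \<pi>) t s \<le> var_pdis M (\<pi> k) (\<pi> k) t s"
proof (intro ballI allI impI)
  fix k t s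
  assume k: "k \<in> {1..K}"
  have "var_pdis M (\<pi> k) (mu_hat M K \<pi>) t s \<le> var_pdis M (\<pi> k) (\<pi> k) t s" for t s
  \<comment> \<open>Backward in time, by the number of remaining steps. Both estimators have mean
    \<open>v_val\<close>, so only second moments have to be compared.\<close>
  proof (induction "horizon M - t" arbitrary: t s)
    case 0
    then show ?case by (simp add: var_pdis_horizon)
  next
    case (Suc n)
    then have t: "t < horizon M" and n: "n = horizon M - Suc t" by auto
    have "var_pdis M (\<pi> k) (mu_hat M K \<pi>) t s \<le>
        (\<Sum>a\<in>UNIV. weight M (\<pi> k) t s a / pmf (mu_hat M K \<pi> t s) a) - (v_val M (\<pi> k) t s)\<^sup>2"
      by (rule var_pdis_off_policy_le[OF _ t Suc.hyps(1)[OF n]]) (rule mu_hat_cover[OF k])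
    also have "\<dots> \<le> (\<Sum>a\<in>UNIV. pmf (\<pi> k t s) a * q_hat M (\<pi> k) t s a) - (v_val M (\<pi> k) t s)\<^sup>2"
      using similarity k t by (intro diff_right_mono sum_weight_div_mu_hat_le) blast+
    finally show ?case by (simp add: var_pdis_on_policy[OF t])
  qed
  then show "var_pdis M (\<pi> k) (mu_hat M K \<pi>) t s \<le> var_pdis M (\<pi> k) (\<pi> k) t s" .
qed

end
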